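(* Let $\sigma$ be a finite signature, and $\mathcal{K}$ a class of causal multiteams of signature $\sigma$. Then $\mathcal{K}$ is definable by a $\mathcal{CO}_{\sigma}$ formula (resp. a set of $\mathcal{CO}_{\sigma}$ formulae) if and only if $\mathcal{K}$ is flat.
   Context: A causal multiteam $T=(T^-,\mathcal F)$ of signature $\sigma=(\mathrm{Dom},\mathrm{Ran})$ consists of a finite multiset $T^-$ of assignments on $\mathrm{Dom}$ and a (recursive) function component $\mathcal F$ giving non-constant structural equations for endogenous variables, compatible with $T^-$. The language $\mathcal{CO}$ is given by $\alpha ::= Y=y \mid Y\neq y \mid \alpha\land\alpha \mid \alpha\lor\alpha \mid \alpha\supset\alpha \mid \mathbf X=\mathbf x\,\Box\!\!\rightarrow\alpha$, where literals hold iff all assignments satisfy them, $\lor$ holds iff $T^-$ splits into two disjoint sub-multiteams satisfying the disjuncts, $\alpha\supset\beta$ holds iff $\beta$ holds in the sub-multiteam of assignments satisfying $\alpha$, and $\mathbf X=\mathbf x\,\Box\!\!\rightarrow\alpha$ holds iff $\alpha$ holds after the intervention setting $\mathbf X$ to $\mathbf x$ (or $\mathbf X=\mathbf x$ is inconsistent). A class $\mathcal K$ is flat if $(T^-,\mathcal F)\in\mathcal K$ iff $(\{s\},\mathcal F)\in\mathcal K$ for every $s\in T^-$. *)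

theory Defs
  imports "HOL-Library.Multiset" "HOL-Library.FuncSet"
begin

record ('v, 'a) signature =
  Dom :: "'v set"
  Ran :: "'v \<Rightarrow> 'a set"

definition signature :: "('v, 'a) signature \<Rightarrow> bool" where
  "signature \<sigma> \<longleftrightarrow> Dom \<sigma> \<noteq> {} \<and> (\<forall>X\<in>Dom \<sigma>. Ran \<sigma> X \<noteq> {})"

definition finite_signature :: "('v, 'a) signature \<Rightarrow> bool" where
  "finite_signature \<sigma> \<longleftrightarrow> signature \<sigma> \<and> finite (Dom \<sigma>) \<and> (\<forall>X\<in>Dom \<sigma>. finite (Ran \<sigma> X))"


subsection \<open>Causal multiteams\<close>

text \<open>
  Assignments and structural functions are extensional functions, so that HOL equality of
  assignments and of function components is equality of the mathematical objects.
\<close>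

type_synonym ('v, 'a) assignment = "'v \<Rightarrow> 'a"
type_synonym ('v, 'a) func_comp = "'v \<rightharpoonup> (('v, 'a) assignment \<Rightarrow> 'a)"
type_synonym ('v, 'a) multiteam = "('v, 'a) assignment multiset"
type_synonym ('v, 'a) causal_multiteam = "('v, 'a) multiteam \<times> ('v, 'a) func_comp"

definition assignments :: "('v, 'a) signature \<Rightarrow> ('v, 'a) assignment set" where
  "assignments \<sigma> = PiE (Dom \<sigma>) (Ran \<sigma>)"

text \<open>The tuples of values of all variables other than \<open>V\<close>: the arguments of a structural
  function for \<open>V\<close>.\<close>

definition arguments :: "('v, 'a) signature \<Rightarrow> 'v \<Rightarrow> ('v, 'a) assignment set" where
  "arguments \<sigma> V = PiE (Dom \<sigma> - {V}) (Ran \<sigma>)"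

text \<open>The non-dummy arguments of the structural function for \<open>V\<close>.\<close>

definition parents :: "('v, 'a) signature \<Rightarrow> ('v, 'a) func_comp \<Rightarrow> 'v \<Rightarrow> 'v set" where
  "parents \<sigma> F V = {X \<in> Dom \<sigma> - {V}. \<exists>f. F V = Some f \<and>
     (\<exists>w\<in>arguments \<sigma> V. \<exists>w'\<in>arguments \<sigma> V.
        (\<forall>Y\<in>Dom \<sigma> - {V, X}. w Y = w' Y) \<and> f w \<noteq> f w')}"

definition causal_graph :: "('v, 'a) signature \<Rightarrow> ('v, 'a) func_comp \<Rightarrow> ('v \<times> 'v) set" where
  "causal_graph \<sigma> F = {(X, V). V \<in> dom F \<and> X \<in> parents \<sigma> F V}"

text \<open>The endogenous variables are those in \<open>dom F\<close>.\<close>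

definition function_component :: "('v, 'a) signature \<Rightarrow> ('v, 'a) func_comp \<Rightarrow> bool" where
  "function_component \<sigma> F \<longleftrightarrow>
     dom F \<subseteq> Dom \<sigma> \<and>
     (\<forall>V f. F V = Some f \<longrightarrow>
        f \<in> arguments \<sigma> V \<rightarrow>\<^sub>E Ran \<sigma> V \<and>
        (\<exists>w\<in>arguments \<sigma> V. \<exists>w'\<in>arguments \<sigma> V. f w \<noteq> f w')) \<and>
     acyclic (causal_graph \<sigma> F)"

definition compatible ::
  "('v, 'a) signature \<Rightarrow> ('v, 'a) assignment \<Rightarrow> ('v, 'a) func_comp \<Rightarrow> bool" where
  "compatible \<sigma> s F \<longleftrightarrow> (\<forall>V f. F V = Some f \<longrightarrow> f (restrict s (Dom \<sigma> - {V})) = s V)"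

definition causal_multiteams :: "('v, 'a) signature \<Rightarrow> ('v, 'a) causal_multiteam set" where
  "causal_multiteams \<sigma> = {(M, F). function_component \<sigma> F \<and>
     (\<forall>s\<in>#M. s \<in> assignments \<sigma> \<and> compatible \<sigma> s F)}"


subsection \<open>Interventions\<close>

text \<open>
  A conjunction \<open>X\<^sub>1 = x\<^sub>1 \<and> \<dots> \<and> X\<^sub>n = x\<^sub>n\<close> is a list of pairs, possibly with repeated variables.
\<close>

type_synonym ('v, 'a) equations = "('v \<times> 'a) list"

definition consistent :: "('v, 'a) equations \<Rightarrow> bool" where
  "consistent ps \<longleftrightarrow> (\<forall>X x x'. (X, x) \<in> set ps \<and> (X, x') \<in> set ps \<longrightarrow> x = x')"

definition equations_over :: "('v, 'a) signature \<Rightarrow> ('v, 'a) equations \<Rightarrow> bool" where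
  "equations_over \<sigma> ps \<longleftrightarrow> (\<forall>(X, x)\<in>set ps. X \<in> Dom \<sigma> \<and> x \<in> Ran \<sigma> X)"

definition intervened_value :: "('v, 'a) signature \<Rightarrow> ('v, 'a) func_comp \<Rightarrow> ('v, 'a) equations \<Rightarrow>
    ('v, 'a) assignment \<Rightarrow> ('v, 'a) assignment \<Rightarrow> 'v \<Rightarrow> 'a" where
  "intervened_value \<sigma> F ps s t V =
     (case map_of ps V of
        Some x \<Rightarrow> x
      | None \<Rightarrow> (case F V of
          None \<Rightarrow> s V
        | Some f \<Rightarrow> f (restrict t (Dom \<sigma> - {V}))))"

text \<open>
  By recursiveness the description below determines exactly one assignment; see
  \<open>ex1_intervened_assignment\<close>.
\<close>

definition intervene_assignment :: "('v, 'a) signature \<Rightarrow> ('v, 'a) func_comp \<Rightarrow>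
    ('v, 'a) equations \<Rightarrow> ('v, 'a) assignment \<Rightarrow> ('v, 'a) assignment" where
  "intervene_assignment \<sigma> F ps s =
     (THE t. t \<in> assignments \<sigma> \<and> (\<forall>V\<in>Dom \<sigma>. t V = intervened_value \<sigma> F ps s t V))"

definition intervene_func_comp ::
  "('v, 'a) equations \<Rightarrow> ('v, 'a) func_comp \<Rightarrow> ('v, 'a) func_comp" where
  "intervene_func_comp ps F = F |` (- fst ` set ps)"

definition intervene :: "('v, 'a) signature \<Rightarrow> ('v, 'a) equations \<Rightarrow>
    ('v, 'a) causal_multiteam \<Rightarrow> ('v, 'a) causal_multiteam" where
  "intervene \<sigma> ps T =
     (image_mset (intervene_assignment \<sigma> (snd T) ps) (fst T), intervene_func_comp ps (snd T))"


subsection \<open>The language CO\<close>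

datatype ('v, 'a) formula =
    Eq 'v 'a
  | Neq 'v 'a
  | And "('v, 'a) formula" "('v, 'a) formula"
  | Or "('v, 'a) formula" "('v, 'a) formula"
  | SelImp "('v, 'a) formula" "('v, 'a) formula"
  | Cf "('v, 'a) equations" "('v, 'a) formula"

primrec formula_over :: "('v, 'a) signature \<Rightarrow> ('v, 'a) formula \<Rightarrow> bool" where
  "formula_over \<sigma> (Eq Y y) \<longleftrightarrow> Y \<in> Dom \<sigma> \<and> y \<in> Ran \<sigma> Y"
| "formula_over \<sigma> (Neq Y y) \<longleftrightarrow> Y \<in> Dom \<sigma> \<and> y \<in> Ran \<sigma> Y"
| "formula_over \<sigma> (And \<alpha> \<beta>) \<longleftrightarrow> formula_over \<sigma> \<alpha> \<and> formula_over \<sigma> \<beta>"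
| "formula_over \<sigma> (Or \<alpha> \<beta>) \<longleftrightarrow> formula_over \<sigma> \<alpha> \<and> formula_over \<sigma> \<beta>"
| "formula_over \<sigma> (SelImp \<alpha> \<beta>) \<longleftrightarrow> formula_over \<sigma> \<alpha> \<and> formula_over \<sigma> \<beta>"
| "formula_over \<sigma> (Cf ps \<alpha>) \<longleftrightarrow> equations_over \<sigma> ps \<and> formula_over \<sigma> \<alpha>"

definition CO :: "('v, 'a) signature \<Rightarrow> ('v, 'a) formula set" where
  "CO \<sigma> = {\<phi>. formula_over \<sigma> \<phi>}"

primrec sat :: "('v, 'a) signature \<Rightarrow> ('v, 'a) causal_multiteam \<Rightarrow> ('v, 'a) formula \<Rightarrow> bool" where
  "sat \<sigma> T (Eq Y y) \<longleftrightarrow> (\<forall>s\<in>#fst T. s Y = y)"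
| "sat \<sigma> T (Neq Y y) \<longleftrightarrow> (\<forall>s\<in>#fst T. s Y \<noteq> y)"
| "sat \<sigma> T (And \<alpha> \<beta>) \<longleftrightarrow> sat \<sigma> T \<alpha> \<and> sat \<sigma> T \<beta>"
| "sat \<sigma> T (Or \<alpha> \<beta>) \<longleftrightarrow>
     (\<exists>M1 M2. M1 + M2 = fst T \<and> sat \<sigma> (M1, snd T) \<alpha> \<and> sat \<sigma> (M2, snd T) \<beta>)"
| "sat \<sigma> T (SelImp \<alpha> \<beta>) \<longleftrightarrow>
     sat \<sigma> ({#s \<in># fst T. sat \<sigma> ({#s#}, snd T) \<alpha>#}, snd T) \<beta>"
| "sat \<sigma> T (Cf ps \<alpha>) \<longleftrightarrow> (consistent ps \<longrightarrow> sat \<sigma> (intervene \<sigma> ps T) \<alpha>)"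


subsection \<open>Definability and flatness\<close>

definition definable_by_formula ::
  "('v, 'a) signature \<Rightarrow> ('v, 'a) causal_multiteam set \<Rightarrow> bool" where
  "definable_by_formula \<sigma> K \<longleftrightarrow>
     (\<exists>\<phi>\<in>CO \<sigma>. K = {T \<in> causal_multiteams \<sigma>. sat \<sigma> T \<phi>})"

definition definable_by_formula_set ::
  "('v, 'a) signature \<Rightarrow> ('v, 'a) causal_multiteam set \<Rightarrow> bool" where
  "definable_by_formula_set \<sigma> K \<longleftrightarrow>
     (\<exists>\<Gamma>\<subseteq>CO \<sigma>. K = {T \<in> causal_multiteams \<sigma>. \<forall>\<phi>\<in>\<Gamma>. sat \<sigma> T \<phi>})"

definition flat :: "('v, 'a) signature \<Rightarrow> ('v, 'a) causal_multiteam set \<Rightarrow> bool" where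
  "flat \<sigma> K \<longleftrightarrow> (\<forall>(M, F)\<in>causal_multiteams \<sigma>. (M, F) \<in> K \<longleftrightarrow> (\<forall>s\<in>#M. ({#s#}, F) \<in> K))"


subsection \<open>Interventions are well defined\<close>

lemma restrict_in_arguments: "t \<in> assignments \<sigma> \<Longrightarrow> restrict t (Dom \<sigma> - {V}) \<in> arguments \<sigma> V"
  by (auto simp: assignments_def arguments_def PiE_iff)

lemma eq_on_parents:
  assumes fin: "finite (Dom \<sigma>)" and F: "F V = Some f"
    and w: "w \<in> arguments \<sigma> V" "w' \<in> arguments \<sigma> V"
    and eq: "\<forall>X\<in>parents \<sigma> F V. w X = w' X"
  shows "f w = f w'"
proof -
  define mix where "mix A = (\<lambda>X. if X \<in> A then w' X else w X)" for A
  have mix: "mix A \<in> arguments \<sigma> V" for A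
    using w by (auto simp: mix_def arguments_def PiE_iff extensional_def)
  have "f (mix A) = f w" if "finite A" "A \<subseteq> Dom \<sigma> - {V}" for A
    using that
  proof (induction A)
    case empty
    then show ?case by (simp add: mix_def)
  next
    case (insert X A)
    have "f (mix (insert X A)) = f (mix A)"
    proof (cases "X \<in> parents \<sigma> F V")
      case True
      then have "mix (insert X A) = mix A"
        using eq by (auto simp: mix_def)
      then show ?thesis by simp
    next
      case False
      moreover have "\<forall>Y\<in>Dom \<sigma> - {V, X}. mix (insert X A) Y = mix A Y"
        by (auto simp: mix_def)
      ultimately show ?thesis
        using insert.prems F mix[of A] mix[of "insert X A"] unfolding parents_def by blast
    qed
    then show ?case using insert by simp
  qed
  from this[of "Dom \<sigma> - {V}"] fin have "f (mix (Dom \<sigma> - {V})) = f w" by simp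
  moreover have "mix (Dom \<sigma> - {V}) = w'"
    using w by (auto simp: mix_def arguments_def PiE_iff extensional_def fun_eq_iff)
  ultimately show ?thesis by simp
qed

lemma intervened_value_cong:
  assumes "finite (Dom \<sigma>)" "t \<in> assignments \<sigma>" "t' \<in> assignments \<sigma>"
    and "\<And>X. (X, V) \<in> causal_graph \<sigma> F \<Longrightarrow> t X = t' X"
  shows "intervened_value \<sigma> F ps s t V = intervened_value \<sigma> F ps s t' V"
proof (cases "F V")
  case None
  then show ?thesis by (simp add: intervened_value_def split: option.split)
next
  case (Some f)
  have "f (restrict t (Dom \<sigma> - {V})) = f (restrict t' (Dom \<sigma> - {V}))"
    using Some assms
    by (intro eq_on_parents[of \<sigma> F V f]) (auto simp: restrict_in_arguments causal_graph_def)
  then show ?thesis using Some by (simp add: intervened_value_def split: option.split)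
qed

lemma wf_causal_graph:
  assumes "finite (Dom \<sigma>)" "function_component \<sigma> F"
  shows "wf (causal_graph \<sigma> F)"
proof (rule finite_acyclic_wf)
  have "causal_graph \<sigma> F \<subseteq> Dom \<sigma> \<times> Dom \<sigma>"
    using assms by (auto simp: causal_graph_def parents_def function_component_def)
  then show "finite (causal_graph \<sigma> F)"
    using assms by (meson finite_SigmaI finite_subset)
  show "acyclic (causal_graph \<sigma> F)"
    using assms by (simp add: function_component_def)
qed

lemma ex1_intervened_assignment:
  assumes fin: "finite (Dom \<sigma>)" and F: "function_component \<sigma> F"
    and s: "s \<in> assignments \<sigma>" and ps: "equations_over \<sigma> ps"
  shows "\<exists>!t. t \<in> assignments \<sigma> \<and> (\<forall>V\<in>Dom \<sigma>. t V = intervened_value \<sigma> F ps s t V)"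
proof -
  define H where "H t = restrict (intervened_value \<sigma> F ps s t) (Dom \<sigma>)" for t
  have H: "H t \<in> assignments \<sigma>" if t: "t \<in> assignments \<sigma>" for t
  proof -
    have "intervened_value \<sigma> F ps s t V \<in> Ran \<sigma> V" if V: "V \<in> Dom \<sigma>" for V
    proof (cases "map_of ps V")
      case (Some x)
      then show ?thesis
        using ps by (auto simp: intervened_value_def equations_over_def dest!: map_of_SomeD)
    next
      case None
      show ?thesis
      proof (cases "F V")
        case None': None
        then show ?thesis
          using None s V by (auto simp: intervened_value_def assignments_def)
      next
        case (Some f)
        then have "f \<in> arguments \<sigma> V \<rightarrow>\<^sub>E Ran \<sigma> V"
          using F by (simp add: function_component_def)
        then show ?thesis
          using None Some restrict_in_arguments[OF t, of V]
          by (auto simp: intervened_value_def)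
      qed
    qed
    then show ?thesis by (auto simp: H_def assignments_def)
  qed
  have wf: "wf (causal_graph \<sigma> F)" using fin F by (rule wf_causal_graph)
  have outside: "t V = t' V"
    if "t \<in> assignments \<sigma>" "t' \<in> assignments \<sigma>" "V \<notin> Dom \<sigma>" for t t' V
    using that by (auto simp: assignments_def PiE_iff extensional_def)
  show ?thesis
  proof (rule ex_ex1I)
    define it where "it n = (H ^^ n) s" for n
    have it: "it n \<in> assignments \<sigma>" for n
      by (induction n) (auto simp: it_def s H)
    have stab: "\<exists>N. \<forall>n\<ge>N. it n V = it N V" for V
      using wf
    proof (induction V rule: wf_induct_rule)
      case (less V)
      then obtain N where N: "\<And>X n. (X, V) \<in> causal_graph \<sigma> F \<Longrightarrow> n \<ge> N X \<Longrightarrow> it n X = it (N X) X"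
        by metis
      define P where "P = {X. (X, V) \<in> causal_graph \<sigma> F}"
      have "P \<subseteq> Dom \<sigma>" by (auto simp: P_def causal_graph_def parents_def)
      then have "finite P" using fin finite_subset by blast
      define m where "m = sum N P"
      have m: "N X \<le> m" if "X \<in> P" for X
        using \<open>finite P\<close> that by (simp add: m_def member_le_sum)
      have "it n V = it (Suc m) V" if n: "n \<ge> Suc m" for n
      proof (cases "V \<in> Dom \<sigma>")
        case False
        then show ?thesis using it outside by blast
      next
        case True
        obtain k where k: "n = Suc k" "m \<le> k" using n by (cases n) auto
        have "it k X = it m X" if "(X, V) \<in> causal_graph \<sigma> F" for X
          using N[OF that] m[of X] k that by (metis P_def le_trans mem_Collect_eq)
        then have "intervened_value \<sigma> F ps s (it k) V = intervened_value \<sigma> F ps s (it m) V"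
          using fin it by (intro intervened_value_cong) auto
        then show ?thesis using k True by (simp add: it_def H_def)
      qed
      then show ?case by blast
    qed
    then obtain N where N: "\<And>V n. n \<ge> N V \<Longrightarrow> it n V = it (N V) V" by metis
    define m where "m = sum N (Dom \<sigma>)"
    have m: "N X \<le> m" if "X \<in> Dom \<sigma>" for X
      using fin that by (simp add: m_def member_le_sum)
    have "it m V = intervened_value \<sigma> F ps s (it m) V" if "V \<in> Dom \<sigma>" for V
    proof -
      have "it m V = it (Suc m) V" using N[of V m] N[of V "Suc m"] m[OF that] by simp
      then show ?thesis using that by (simp add: it_def H_def)
    qed
    then show "\<exists>t. t \<in> assignments \<sigma> \<and> (\<forall>V\<in>Dom \<sigma>. t V = intervened_value \<sigma> F ps s t V)"
      using it by blast
  next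
    fix t t'
    assume t: "t \<in> assignments \<sigma> \<and> (\<forall>V\<in>Dom \<sigma>. t V = intervened_value \<sigma> F ps s t V)"
      and t': "t' \<in> assignments \<sigma> \<and> (\<forall>V\<in>Dom \<sigma>. t' V = intervened_value \<sigma> F ps s t' V)"
    have "t V = t' V" for V
      using wf
    proof (induction V rule: wf_induct_rule)
      case (less V)
      show ?case
      proof (cases "V \<in> Dom \<sigma>")
        case True
        then show ?thesis
          using t t' less intervened_value_cong[OF fin, of t t' V F ps s] by auto
      qed (use t t' outside in blast)
    qed
    then show "t = t'" by blast
  qed
qed

end

theory Submission
  imports Defs
begin

text \<open>
  Every CO formula is evaluated assignment by assignment, so definable classes are flat.
  Conversely, over a finite signature a single formula pins down a one-element causal multiteam
  \<open>({#s#}, F)\<close>: besides the values of \<open>s\<close>, it records for each variable \<open>V\<close> its value after every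
  intervention that fixes all other variables. An endogenous variable responds to these
  interventions exactly as its structural function prescribes, and non-constantly; an exogenous one
  does not respond. A flat class is then defined by excluding the finitely many one-element
  multiteams outside it.
\<close>

section \<open>Flatness of satisfaction\<close>

text \<open>The induction must range over all multiteams and function components: \<open>Or\<close>
  and \<open>SelImp\<close> pass to submultisets, and \<open>Cf\<close> also changes
  \<open>F\<close>.\<close>

lemma sat_flat: "sat \<sigma> (M, F) \<phi> \<longleftrightarrow> (\<forall>s\<in>#M. sat \<sigma> ({#s#}, F) \<phi>)"
proof (induction \<phi> arbitrary: M F)
  case (Or \<alpha> \<beta>)
  \<comment> \<open>At \<open>{#}\<close> the right-hand side of the induction hypothesis is
    vacuous. Splitting a singleton leaves one part empty, so on singletons \<open>Or\<close> becomes
    Boolean disjunction.\<close>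
  have empty: "sat \<sigma> ({#}, F) \<alpha>" "sat \<sigma> ({#}, F) \<beta>"
    using Or.IH[of "{#}" F] by auto
  have single: "sat \<sigma> ({#s#}, F) (Or \<alpha> \<beta>) \<longleftrightarrow> sat \<sigma> ({#s#}, F) \<alpha> \<or> sat \<sigma> ({#s#}, F) \<beta>" for s
    using empty by (auto simp: union_is_single)
  show ?case
  proof
    assume "sat \<sigma> (M, F) (Or \<alpha> \<beta>)"
    then obtain M1 M2 where "M = M1 + M2" "sat \<sigma> (M1, F) \<alpha>" "sat \<sigma> (M2, F) \<beta>"
      by auto
    then show "\<forall>s\<in>#M. sat \<sigma> ({#s#}, F) (Or \<alpha> \<beta>)"
      unfolding single using Or.IH(1)[of M1 F] Or.IH(2)[of M2 F] by auto
  next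
    assume *: "\<forall>s\<in>#M. sat \<sigma> ({#s#}, F) (Or \<alpha> \<beta>)"
    \<comment> \<open>The split gives \<alpha> every assignment it can take; those left over satisfy
      \<beta> by \<open>*\<close>.\<close>
    define M1 where "M1 = {#s \<in># M. sat \<sigma> ({#s#}, F) \<alpha>#}"
    define M2 where "M2 = {#s \<in># M. \<not> sat \<sigma> ({#s#}, F) \<alpha>#}"
    have "M1 + M2 = M"
      by (simp add: M1_def M2_def)
    moreover have "sat \<sigma> (M1, F) \<alpha>"
      using Or.IH(1)[of M1 F] by (auto simp: M1_def)
    moreover have "sat \<sigma> (M2, F) \<beta>"
      using Or.IH(2)[of M2 F] * unfolding single by (auto simp: M2_def)
    ultimately show "sat \<sigma> (M, F) (Or \<alpha> \<beta>)" by auto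
  qed
next
  case (SelImp \<alpha> \<beta>)
  define M' where "M' = {#s \<in># M. sat \<sigma> ({#s#}, F) \<alpha>#}"
  \<comment> \<open>If \<open>s\<close> fails \<alpha>, the selection from \<open>{#s#}\<close> is
    empty and \<beta> is evaluated there.\<close>
  have empty: "sat \<sigma> ({#}, F) \<beta>"
    using SelImp.IH(2)[of "{#}" F] by simp
  have single: "sat \<sigma> ({#s#}, F) (SelImp \<alpha> \<beta>) \<longleftrightarrow>
      (sat \<sigma> ({#s#}, F) \<alpha> \<longrightarrow> sat \<sigma> ({#s#}, F) \<beta>)" for s
    using empty by simp
  have "sat \<sigma> (M, F) (SelImp \<alpha> \<beta>) \<longleftrightarrow> sat \<sigma> (M', F) \<beta>"
    by (simp add: M'_def)
  then show ?case
    unfolding single SelImp.IH(2)[of M' F] by (auto simp: M'_def)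
next
  case (Cf ps \<alpha>)
  \<comment> \<open>An intervention moves each assignment separately, and the new function component
    does not depend on the multiset, so singletons go to singletons.\<close>
  let ?i = "intervene_assignment \<sigma> F ps"
  show ?case
    using Cf.IH[of "image_mset ?i M" "intervene_func_comp ps F"] by (auto simp: intervene_def)
next
  case (And \<alpha> \<beta>)
  show ?case
    using And.IH(1)[of M F] And.IH(2)[of M F] by auto
qed simp_all

section \<open>Finiteness of assignments and function components\<close>

lemma finite_arguments:
  assumes "finite_signature \<sigma>"
  shows "finite (arguments \<sigma> V)"
  using assms by (auto simp: finite_signature_def arguments_def intro!: finite_PiE)

lemma finite_assignments:
  assumes "finite_signature \<sigma>"
  shows "finite (assignments \<sigma>)"
  using assms by (auto simp: finite_signature_def assignments_def intro!: finite_PiE)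

text \<open>A function component is a partial map whose domain lies in a finite set and whose values
  lie in one finite pool \<open>R\<close> of extensional functions.\<close>

lemma finite_function_components:
  assumes "finite_signature \<sigma>"
  shows "finite {F. function_component \<sigma> F}"
proof -
  define R where "R = (\<Union>V\<in>Dom \<sigma>. arguments \<sigma> V \<rightarrow>\<^sub>E Ran \<sigma> V)"
  have "finite R" and fin: "finite (Dom \<sigma>)"
    using assms finite_arguments[OF assms]
    by (auto simp: R_def finite_signature_def intro!: finite_PiE)
  have "finite (\<Union>A\<in>Pow (Dom \<sigma>). {F. dom F = A \<and> ran F \<subseteq> R})"
    using fin \<open>finite R\<close> by (intro finite_UN_I finite_set_of_finite_maps) (auto dest: finite_subset)
  moreover have "{F. function_component \<sigma> F} \<subseteq> (\<Union>A\<in>Pow (Dom \<sigma>). {F. dom F = A \<and> ran F \<subseteq> R})"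
  proof
    fix F assume "F \<in> {F. function_component \<sigma> F}"
    then have "dom F \<subseteq> Dom \<sigma>" and "F V = Some f \<Longrightarrow> f \<in> arguments \<sigma> V \<rightarrow>\<^sub>E Ran \<sigma> V" for V f
      by (simp_all add: function_component_def)
    then have "ran F \<subseteq> R"
      unfolding R_def ran_def by blast
    with \<open>dom F \<subseteq> Dom \<sigma>\<close> show "F \<in> (\<Union>A\<in>Pow (Dom \<sigma>). {F. dom F = A \<and> ran F \<subseteq> R})"
      by simp
  qed
  ultimately show ?thesis by (rule rev_finite_subset)
qed

section \<open>Finite conjunctions and negation within CO\<close>

lemma ex_conjunction:
  assumes "signature \<sigma>" "finite \<Gamma>" "\<Gamma> \<subseteq> CO \<sigma>"
  shows "\<exists>\<phi>\<in>CO \<sigma>. \<forall>T. sat \<sigma> T \<phi> \<longleftrightarrow> (\<forall>\<psi>\<in>\<Gamma>. sat \<sigma> T \<psi>)"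
  using assms(2,3)
proof (induction \<Gamma>)
  case empty
  obtain X x where X: "X \<in> Dom \<sigma>" "x \<in> Ran \<sigma> X"
    using assms(1) unfolding signature_def by blast
  \<comment> \<open>CO has no truth constant; this tautology stands for the empty
    conjunction.\<close>
  let ?\<phi> = "SelImp (Eq X x) (Eq X x)"
  have "?\<phi> \<in> CO \<sigma>" and "\<forall>T. sat \<sigma> T ?\<phi>"
    using X by (auto simp: CO_def)
  then show ?case by blast
next
  case (insert \<psi> \<Gamma>)
  then obtain \<phi> where \<phi>: "\<phi> \<in> CO \<sigma>" "\<forall>T. sat \<sigma> T \<phi> \<longleftrightarrow> (\<forall>\<psi>\<in>\<Gamma>. sat \<sigma> T \<psi>)"
    by auto
  then have "And \<psi> \<phi> \<in> CO \<sigma>" and "\<forall>T. sat \<sigma> T (And \<psi> \<phi>) \<longleftrightarrow> (\<forall>\<psi>\<in>insert \<psi> \<Gamma>. sat \<sigma> T \<psi>)"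
    using insert.prems by (auto simp: CO_def)
  then show ?case by blast
qed

lemma ex_negation:
  assumes "signature \<sigma>" "\<phi> \<in> CO \<sigma>"
  shows "\<exists>\<psi>\<in>CO \<sigma>. \<forall>M F. sat \<sigma> (M, F) \<psi> \<longleftrightarrow> (\<forall>s\<in>#M. \<not> sat \<sigma> ({#s#}, F) \<phi>)"
proof -
  obtain X x where X: "X \<in> Dom \<sigma>" "x \<in> Ran \<sigma> X"
    using assms(1) unfolding signature_def by blast
  \<comment> \<open>The consequent is a contradiction, satisfied by the empty multiteam only, so the
    selection by \<phi> has to be empty.\<close>
  let ?\<psi> = "SelImp \<phi> (And (Eq X x) (Neq X x))"
  have "?\<psi> \<in> CO \<sigma>"
    using X assms(2) by (auto simp: CO_def)
  moreover have "\<forall>M F. sat \<sigma> (M, F) ?\<psi> \<longleftrightarrow> (\<forall>s\<in>#M. \<not> sat \<sigma> ({#s#}, F) \<phi>)"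
    by auto
  ultimately show ?thesis by blast
qed

section \<open>Responses to interventions and characteristic formulas\<close>

text \<open>The value of \<open>V\<close> after an intervention setting all other variables as in
  \<open>w\<close>, as \<open>intervene_on_all_others\<close> confirms. An exogenous
  \<open>V\<close> keeps its value from \<open>s\<close>.\<close>

definition response :: "('v, 'a) func_comp \<Rightarrow> ('v, 'a) assignment \<Rightarrow> 'v \<Rightarrow> ('v, 'a) assignment \<Rightarrow> 'a"
  where "response F s V w = (case F V of None \<Rightarrow> s V | Some f \<Rightarrow> f w)"

lemma response_in_Ran:
  assumes "function_component \<sigma> F" "s \<in> assignments \<sigma>" "V \<in> Dom \<sigma>" "w \<in> arguments \<sigma> V"
  shows "response F s V w \<in> Ran \<sigma> V"
proof (cases "F V")
  case None
  then show ?thesis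
    using assms by (auto simp: response_def assignments_def)
next
  case (Some f)
  then have "f \<in> arguments \<sigma> V \<rightarrow>\<^sub>E Ran \<sigma> V"
    using assms(1) by (simp add: function_component_def)
  then show ?thesis
    using assms(4) Some by (auto simp: response_def)
qed

text \<open>As structural functions are non-constant, a response that is constant in
  \<open>w\<close> reveals an exogenous variable, so equal responses force equal domains. On the
  common domain, responses are the values of the structural functions, which are
  extensional.\<close>

lemma func_comp_eqI:
  assumes F: "function_component \<sigma> F" and G: "function_component \<sigma> G"
    and eq: "\<And>V w. V \<in> Dom \<sigma> \<Longrightarrow> w \<in> arguments \<sigma> V \<Longrightarrow> response F s V w = response G s V w"
  shows "F = G"
proof
  fix V
  have func: "V \<in> Dom \<sigma> \<and> f \<in> arguments \<sigma> V \<rightarrow>\<^sub>E Ran \<sigma> V \<and>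
      (\<exists>w\<in>arguments \<sigma> V. \<exists>w'\<in>arguments \<sigma> V. f w \<noteq> f w')"
    if "function_component \<sigma> H" "H V = Some f" for H f
    using that by (auto simp: function_component_def)
  have not_const: "\<not> (\<exists>c. \<forall>w\<in>arguments \<sigma> V. response H s V w = c)"
    if "function_component \<sigma> H" "H V = Some f" for H f
    using func[OF that] that(2) unfolding response_def by (metis option.simps(5))
  show "F V = G V"
  proof (cases "F V")
    case None
    then have "response F s V w = s V" for w
      by (simp add: response_def)
    then have "G V \<noteq> Some g" for g
      using eq[of V] not_const[OF G, of g] func[OF G, of g] by metis
    then show ?thesis
      using None by (cases "G V") auto
  next
    case F': (Some f)
    show ?thesis
    proof (cases "G V")
      case None
      then have "response G s V w = s V" for w
        by (simp add: response_def)
      then show ?thesis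
        using eq[of V] not_const[OF F F'] func[OF F F'] by metis
    next
      case G': (Some g)
      have "f = g"
        using func[OF F F'] func[OF G G'] eq[of V] F' G'
        by (intro PiE_ext[of f "arguments \<sigma> V" "\<lambda>_. Ran \<sigma> V" g]) (auto simp: response_def)
      then show ?thesis using F' G' by simp
    qed
  qed
qed

lemma intervene_on_all_others:
  assumes fin: "finite (Dom \<sigma>)" and F: "function_component \<sigma> F" and s: "s \<in> assignments \<sigma>"
    and V: "V \<in> Dom \<sigma>" and w: "w \<in> arguments \<sigma> V"
    and xs: "set xs = Dom \<sigma> - {V}"
  shows "intervene_assignment \<sigma> F (map (\<lambda>X. (X, w X)) xs) s V = response F s V w"
proof -
  define ps where "ps = map (\<lambda>X. (X, w X)) xs"
  define t where "t = intervene_assignment \<sigma> F ps s"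
  have "equations_over \<sigma> ps"
    using w xs by (auto simp: equations_over_def ps_def arguments_def)
  \<comment> \<open>Unique existence turns the description by \<open>THE\<close> into usable
    equations for \<open>t\<close>.\<close>
  from theI'[OF ex1_intervened_assignment[OF fin F s this]]
  have t: "t X = intervened_value \<sigma> F ps s t X" if "X \<in> Dom \<sigma>" for X
    using that by (simp add: t_def intervene_assignment_def)
  have ps: "map_of ps X = (if X \<in> Dom \<sigma> - {V} then Some (w X) else None)" for X
    by (simp add: ps_def map_of_map_restrict xs restrict_map_def)
  have "restrict t (Dom \<sigma> - {V}) = restrict w (Dom \<sigma> - {V})"
    by (rule restrict_ext) (auto simp: t intervened_value_def ps)
  also have "\<dots> = w"
    using w unfolding arguments_def by (rule PiE_restrict)
  finally have "t V = response F s V w"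
    \<comment> \<open>\<open>V\<close> itself is not intervened upon, so its equation falls back on
      \<open>F V\<close>, evaluated at \<open>w\<close>, or on \<open>s V\<close>.\<close>
    using t[OF V] by (simp add: intervened_value_def ps response_def split: option.split)
  then show ?thesis by (simp add: t_def ps_def)
qed

lemma ex_response_formula:
  assumes fin: "finite (Dom \<sigma>)" and V: "V \<in> Dom \<sigma>" and w: "w \<in> arguments \<sigma> V"
    and y: "y \<in> Ran \<sigma> V"
  shows "\<exists>\<phi>\<in>CO \<sigma>. \<forall>t G. t \<in> assignments \<sigma> \<longrightarrow> function_component \<sigma> G \<longrightarrow>
    (sat \<sigma> ({#t#}, G) \<phi> \<longleftrightarrow> response G t V w = y)"
proof -
  obtain xs where xs: "set xs = Dom \<sigma> - {V}"
    using fin finite_list[of "Dom \<sigma> - {V}"] by auto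
  let ?ps = "map (\<lambda>X. (X, w X)) xs"
  \<comment> \<open>Each variable is paired with \<open>w X\<close> only, even if \<open>xs\<close>
    has repetitions. Consistency keeps the counterfactual below from holding vacuously.\<close>
  have "equations_over \<sigma> ?ps" "consistent ?ps"
    using w xs by (auto simp: equations_over_def consistent_def arguments_def)
  then have "Cf ?ps (Eq V y) \<in> CO \<sigma>"
    and "\<forall>t G. t \<in> assignments \<sigma> \<longrightarrow> function_component \<sigma> G \<longrightarrow>
      (sat \<sigma> ({#t#}, G) (Cf ?ps (Eq V y)) \<longleftrightarrow> response G t V w = y)"
    using V y intervene_on_all_others[OF fin _ _ V w xs] by (auto simp: CO_def intervene_def)
  then show ?thesis by blast
qed

lemma ex_characteristic_formula:
  assumes \<sigma>: "finite_signature \<sigma>" and s: "s \<in> assignments \<sigma>" and F: "function_component \<sigma> F"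
  shows "\<exists>\<phi>\<in>CO \<sigma>. \<forall>t G. t \<in> assignments \<sigma> \<longrightarrow> function_component \<sigma> G \<longrightarrow>
    (sat \<sigma> ({#t#}, G) \<phi> \<longleftrightarrow> t = s \<and> G = F)"
proof -
  have fin: "finite (Dom \<sigma>)" and sig: "signature \<sigma>"
    using \<sigma> by (auto simp: finite_signature_def)
  define Q where "Q V w \<phi> \<longleftrightarrow> \<phi> \<in> CO \<sigma> \<and>
    (\<forall>t G. t \<in> assignments \<sigma> \<longrightarrow> function_component \<sigma> G \<longrightarrow>
      (sat \<sigma> ({#t#}, G) \<phi> \<longleftrightarrow> response G t V w = response F s V w))" for V w \<phi>
  define \<rho> where "\<rho> V w = (SOME \<phi>. Q V w \<phi>)" for V w
  have "Q V w (\<rho> V w)" if "V \<in> Dom \<sigma>" "w \<in> arguments \<sigma> V" for V w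
  proof -
    have "\<exists>\<phi>. Q V w \<phi>"
      using ex_response_formula[OF fin that response_in_Ran[OF F s that]]
      unfolding Q_def by blast
    then show ?thesis
      unfolding \<rho>_def by (rule someI_ex)
  qed
  then have \<rho>: "\<rho> V w \<in> CO \<sigma>"
      "t \<in> assignments \<sigma> \<Longrightarrow> function_component \<sigma> G \<Longrightarrow>
        sat \<sigma> ({#t#}, G) (\<rho> V w) \<longleftrightarrow> response G t V w = response F s V w"
    if "V \<in> Dom \<sigma>" "w \<in> arguments \<sigma> V" for V w t G
    using that by (simp_all add: Q_def)
  \<comment> \<open>The equations force \<open>t = s\<close>; only then do the formulas from \<rho>
    compare responses of \<open>G\<close> and \<open>F\<close> at the same assignment, as
    \<open>func_comp_eqI\<close> requires.\<close>
  define \<Gamma> where "\<Gamma> = (\<lambda>V. Eq V (s V)) ` Dom \<sigma> \<union> (\<Union>V\<in>Dom \<sigma>. \<rho> V ` arguments \<sigma> V)"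
  have "finite \<Gamma>"
    using fin finite_arguments[OF \<sigma>] by (simp add: \<Gamma>_def)
  moreover have "\<Gamma> \<subseteq> CO \<sigma>"
    using \<rho>(1) s by (auto simp: \<Gamma>_def CO_def assignments_def)
  ultimately obtain \<phi> where \<phi>: "\<phi> \<in> CO \<sigma>" "\<And>T. sat \<sigma> T \<phi> \<longleftrightarrow> (\<forall>\<psi>\<in>\<Gamma>. sat \<sigma> T \<psi>)"
    using ex_conjunction[OF sig] by blast
  have "sat \<sigma> ({#t#}, G) \<phi> \<longleftrightarrow> t = s \<and> G = F"
    if t: "t \<in> assignments \<sigma>" and G: "function_component \<sigma> G" for t G
  proof -
    have "sat \<sigma> ({#t#}, G) \<phi> \<longleftrightarrow> (\<forall>V\<in>Dom \<sigma>. t V = s V) \<and>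
        (\<forall>V\<in>Dom \<sigma>. \<forall>w\<in>arguments \<sigma> V. response G t V w = response F s V w)"
      using \<rho>(2)[OF _ _ t G] by (simp add: \<phi>(2) \<Gamma>_def ball_Un)
    also have "(\<forall>V\<in>Dom \<sigma>. t V = s V) \<longleftrightarrow> t = s"
      using t s PiE_ext[of t "Dom \<sigma>" "Ran \<sigma>" s] by (auto simp: assignments_def)
    finally show ?thesis
      using func_comp_eqI[OF G F, of s] by auto
  qed
  then show ?thesis using \<phi>(1) by blast
qed

section \<open>Definable classes and flat classes\<close>

lemma single_in_causal_multiteams:
  assumes "(M, F) \<in> causal_multiteams \<sigma>" "s \<in># M"
  shows "({#s#}, F) \<in> causal_multiteams \<sigma>"
  using assms by (auto simp: causal_multiteams_def)

lemma definable_by_formula_set_imp_flat: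
  assumes "definable_by_formula_set \<sigma> K"
  shows "flat \<sigma> K"
proof -
  obtain \<Gamma> where K: "K = {T \<in> causal_multiteams \<sigma>. \<forall>\<phi>\<in>\<Gamma>. sat \<sigma> T \<phi>}"
    using assms by (auto simp: definable_by_formula_set_def)
  have "(M, F) \<in> K \<longleftrightarrow> (\<forall>s\<in>#M. ({#s#}, F) \<in> K)" if "(M, F) \<in> causal_multiteams \<sigma>" for M F
    using that sat_flat[of \<sigma> M F] single_in_causal_multiteams[OF that] unfolding K by blast
  then show ?thesis by (auto simp: flat_def)
qed

lemma definable_by_formula_imp_set:
  assumes "definable_by_formula \<sigma> K"
  shows "definable_by_formula_set \<sigma> K"
proof -
  obtain \<phi> where "\<phi> \<in> CO \<sigma>" "K = {T \<in> causal_multiteams \<sigma>. sat \<sigma> T \<phi>}"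
    using assms by (auto simp: definable_by_formula_def)
  then show ?thesis
    unfolding definable_by_formula_set_def by (intro exI[of _ "{\<phi>}"]) auto
qed

lemma flat_imp_definable_by_formula:
  assumes \<sigma>: "finite_signature \<sigma>" and K: "K \<subseteq> causal_multiteams \<sigma>" and flat: "flat \<sigma> K"
  shows "definable_by_formula \<sigma> K"
proof -
  have sig: "signature \<sigma>" using \<sigma> by (simp add: finite_signature_def)
  \<comment> \<open>Pairs with \<open>s\<close> incompatible with \<open>F\<close> also fall into
    \<open>P\<close>, since \<open>K\<close> contains causal multiteams only. Excluding them is
    harmless: no causal multiteam realizes them.\<close>
  define P where "P = {(s, F) \<in> assignments \<sigma> \<times> {F. function_component \<sigma> F}. ({#s#}, F) \<notin> K}"
  have "finite P"
    by (rule finite_subset[OF _ finite_cartesian_product[OF finite_assignments[OF \<sigma>]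
          finite_function_components[OF \<sigma>]]]) (auto simp: P_def)
  have "\<exists>\<psi>. \<psi> \<in> CO \<sigma> \<and>
      (\<forall>M G. (M, G) \<in> causal_multiteams \<sigma> \<longrightarrow> (sat \<sigma> (M, G) \<psi> \<longleftrightarrow> (\<forall>t\<in>#M. (t, G) \<noteq> p)))"
    if "p \<in> P" for p
  proof -
    obtain s F where p: "p = (s, F)" and s: "s \<in> assignments \<sigma>" and F: "function_component \<sigma> F"
      using \<open>p \<in> P\<close> by (auto simp: P_def)
    obtain \<phi> where \<phi>: "\<phi> \<in> CO \<sigma>" "\<And>t G. t \<in> assignments \<sigma> \<Longrightarrow> function_component \<sigma> G \<Longrightarrow>
        sat \<sigma> ({#t#}, G) \<phi> \<longleftrightarrow> t = s \<and> G = F"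
      using ex_characteristic_formula[OF \<sigma>, of s F] s F by blast
    obtain \<psi> where \<psi>: "\<psi> \<in> CO \<sigma>"
        "\<And>M G. sat \<sigma> (M, G) \<psi> \<longleftrightarrow> (\<forall>t\<in>#M. \<not> sat \<sigma> ({#t#}, G) \<phi>)"
      using ex_negation[OF sig \<phi>(1)] by blast
    have "\<forall>M G. (M, G) \<in> causal_multiteams \<sigma> \<longrightarrow>
        (sat \<sigma> (M, G) \<psi> \<longleftrightarrow> (\<forall>t\<in>#M. (t, G) \<noteq> p))"
      using \<phi>(2) by (auto simp: \<psi>(2) p causal_multiteams_def)
    with \<psi>(1) show ?thesis by blast
  qed
  then have "\<exists>\<nu>. \<forall>p\<in>P. \<nu> p \<in> CO \<sigma> \<and>
      (\<forall>M G. (M, G) \<in> causal_multiteams \<sigma> \<longrightarrow> (sat \<sigma> (M, G) (\<nu> p) \<longleftrightarrow> (\<forall>t\<in>#M. (t, G) \<noteq> p)))"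
    by (intro bchoice ballI)
  then obtain \<nu> where \<nu>: "\<And>p. p \<in> P \<Longrightarrow> \<nu> p \<in> CO \<sigma>"
      "\<And>p M G. p \<in> P \<Longrightarrow> (M, G) \<in> causal_multiteams \<sigma> \<Longrightarrow>
        sat \<sigma> (M, G) (\<nu> p) \<longleftrightarrow> (\<forall>t\<in>#M. (t, G) \<noteq> p)"
    by blast
  obtain \<phi> where \<phi>: "\<phi> \<in> CO \<sigma>" "\<And>T. sat \<sigma> T \<phi> \<longleftrightarrow> (\<forall>\<psi>\<in>\<nu> ` P. sat \<sigma> T \<psi>)"
    using ex_conjunction[OF sig, of "\<nu> ` P"] \<open>finite P\<close> \<nu>(1) by blast
  have "(M, G) \<in> K \<longleftrightarrow> sat \<sigma> (M, G) \<phi>" if T: "(M, G) \<in> causal_multiteams \<sigma>" for M G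
  proof -
    have "sat \<sigma> (M, G) \<phi> \<longleftrightarrow> (\<forall>t\<in>#M. (t, G) \<notin> P)"
      using \<nu>(2)[OF _ T] by (auto simp: \<phi>(2))
    \<comment> \<open>In a causal multiteam every \<open>t\<close> is an assignment and
      \<open>G\<close> a function component, so \<open>(t, G)\<close> can avoid \<open>P\<close>
      only by its singleton lying in \<open>K\<close>.\<close>
    also have "\<dots> \<longleftrightarrow> (\<forall>t\<in>#M. ({#t#}, G) \<in> K)"
      using T by (auto simp: P_def causal_multiteams_def)
    also have "\<dots> \<longleftrightarrow> (M, G) \<in> K"
      using flat T by (auto simp: flat_def)
    finally show ?thesis by simp
  qed
  then have "K = {T \<in> causal_multiteams \<sigma>. sat \<sigma> T \<phi>}"
    using K by auto
  with \<phi>(1) show ?thesis by (auto simp: definable_by_formula_def)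
qed

theorem theorem2:
  fixes \<sigma> :: "('v, 'a) signature"
    and K :: "('v, 'a) causal_multiteam set"
  assumes "finite_signature \<sigma>"
    and "K \<subseteq> causal_multiteams \<sigma>"
  shows "(definable_by_formula \<sigma> K \<longleftrightarrow> flat \<sigma> K) \<and>
         (definable_by_formula_set \<sigma> K \<longleftrightarrow> flat \<sigma> K)"
  using flat_imp_definable_by_formula[OF assms] definable_by_formula_imp_set
    definable_by_formula_set_imp_flat by blast

end
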